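(* Let $\mathcal{F}$ be a family of finite graphs, and set $\chi=\chi(\mathcal{F})\ge 2$ and $\alpha=\alpha(\mathcal{F})$. Comparability graphs with chromatic number at most $\chi-1$ are indistinguishable from $\mathcal{F}$-free comparability graphs. Namely, every comparability graph with chromatic number at most $\chi-1$ is $\mathcal{F}$-free, and every $\mathcal{F}$-free comparability graph $G$ admits a spanning subgraph with chromatic number at most $\chi-1$ that is a comparability graph, obtained by the removal of at most $2\left(\frac{\chi^2\alpha^2}{|V(G)|}\right)^{\frac{1}{\chi\alpha^2}}|V(G)|^2$ edges.
   Context: All graphs are finite, simple and undirected. The comparability graph of a poset $(P,\prec)$ (where $\prec$ is anti-reflexive and transitive) is the graph with vertex set $P$ in which $x,y$ are adjacent iff $x\prec y$ or $y\prec x$; a comparability graph is a graph arising in this way from some poset. For a (possibly infinite) family $\mathcal{F}$ of finite graphs, $\chi(\mathcal{F})=\min_{F\in\mathcal{F}}\chi(F)$ and $\alpha(\mathcal{F})=\min\{\alpha(F):F\in\mathcal{F},\ \chi(F)=\chi(\mathcal{F})\}$, where $\chi(F)$ is the chromatic number and $\alpha(F)$ the independence number of $F$. $G$ is $\mathcal{F}$-free if it has no (not necessarily induced) subgraph isomorphic to a member of $\mathcal{F}$. Two properties (isomorphism-closed classes) $\Phi_1,\Phi_2$ of graphs are indistinguishable if for every $\varepsilon>0$ and $i=1,2$ there exists $N$ such that for every graph $G$ on at least $N$ vertices with property $\Phi_i$ there exists a graph $G'$ on the same vertex set with property $\Phi_{3-i}$ obtained by changing at most $\varepsilon|V(G)|^2$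 edges of $G$. *)

theory Defs
  imports Complex_Main "HOL-Library.Ramsey"
begin

text \<open>A graph is a pair of a vertex set and an edge set, an edge being the 2-element set of its
  endpoints.\<close>

type_synonym 'a graph = "'a set \<times> 'a set set"

abbreviation verts :: "'a graph \<Rightarrow> 'a set" where "verts \<equiv> fst"
abbreviation edges :: "'a graph \<Rightarrow> 'a set set" where "edges \<equiv> snd"

definition fin_graph :: "'a graph \<Rightarrow> bool" where
  "fin_graph G \<longleftrightarrow> finite (verts G) \<and> edges G \<subseteq> [verts G]\<^bsup>2\<^esup>"

definition isomorphic :: "'a graph \<Rightarrow> 'b graph \<Rightarrow> bool" where
  "isomorphic G H \<longleftrightarrow> (\<exists>f. bij_betw f (verts G) (verts H) \<and> edges H = (`) f ` edges G)"

definition subgraph :: "'a graph \<Rightarrow> 'a graph \<Rightarrow> bool" where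
  "subgraph H G \<longleftrightarrow>
     fin_graph H \<and> fin_graph G \<and> verts H \<subseteq> verts G \<and> edges H \<subseteq> edges G"

definition spanning_subgraph :: "'a graph \<Rightarrow> 'a graph \<Rightarrow> bool" where
  "spanning_subgraph H G \<longleftrightarrow> subgraph H G \<and> verts H = verts G"

definition proper_coloring :: "'a graph \<Rightarrow> nat \<Rightarrow> ('a \<Rightarrow> nat) \<Rightarrow> bool" where
  "proper_coloring G k c \<longleftrightarrow>
     c ` verts G \<subseteq> {..<k} \<and> (\<forall>x y. {x, y} \<in> edges G \<longrightarrow> c x \<noteq> c y)"

definition chromatic_number :: "'a graph \<Rightarrow> nat" where
  "chromatic_number G = (LEAST k. \<exists>c. proper_coloring G k c)"

definition independence_number :: "'a graph \<Rightarrow> nat" where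
  "independence_number G = Max {card S | S. S \<subseteq> verts G \<and> indep S (edges G)}"

definition comparability_graph_of :: "'a set \<Rightarrow> ('a \<Rightarrow> 'a \<Rightarrow> bool) \<Rightarrow> 'a graph" where
  "comparability_graph_of P R = (P, {{x, y} | x y. x \<in> P \<and> y \<in> P \<and> (R x y \<or> R y x)})"

definition comparability_graph :: "'a graph \<Rightarrow> bool" where
  "comparability_graph G \<longleftrightarrow> finite (verts G) \<and>
     (\<exists>R. irreflp_on (verts G) R \<and> transp_on (verts G) R
        \<and> G = comparability_graph_of (verts G) R)"

text \<open>On \<^typ>\<open>nat\<close>, the infimum of a nonempty set is its minimum.\<close>

definition family_chi :: "'b graph set \<Rightarrow> nat" where
  "family_chi \<F> = (INF F\<in>\<F>. chromatic_number F)"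

definition family_alpha :: "'b graph set \<Rightarrow> nat" where
  "family_alpha \<F> = (INF F\<in>{F \<in> \<F>. chromatic_number F = family_chi \<F>}. independence_number F)"

text \<open>The members of the family may live on another vertex type than \<open>G\<close>; with \<^typ>\<open>nat\<close> as
  \<open>'b\<close> every family of finite graphs is covered up to isomorphism.\<close>

definition family_free :: "'b graph set \<Rightarrow> 'a graph \<Rightarrow> bool" where
  "family_free \<F> G \<longleftrightarrow> \<not> (\<exists>F\<in>\<F>. \<exists>H. subgraph H G \<and> isomorphic F H)"

definition graph_property :: "('a graph \<Rightarrow> bool) \<Rightarrow> bool" where
  "graph_property \<Phi> \<longleftrightarrow> (\<forall>G. \<Phi> G \<longrightarrow> fin_graph G)
     \<and> (\<forall>G H. \<Phi> G \<and> fin_graph H \<and> isomorphic G H \<longrightarrow> \<Phi> H)"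

definition approximable_by :: "('a graph \<Rightarrow> bool) \<Rightarrow> ('a graph \<Rightarrow> bool) \<Rightarrow> bool" where
  "approximable_by \<Phi> \<Psi> \<longleftrightarrow>
     (\<forall>\<epsilon>::real. \<epsilon> > 0 \<longrightarrow> (\<exists>N::nat. \<forall>G. \<Phi> G \<and> card (verts G) \<ge> N \<longrightarrow>
        (\<exists>G'. \<Psi> G' \<and> verts G' = verts G \<and>
           real (card (sym_diff (edges G) (edges G'))) \<le> \<epsilon> * real (card (verts G)) ^ 2)))"

definition indistinguishable :: "('a graph \<Rightarrow> bool) \<Rightarrow> ('a graph \<Rightarrow> bool) \<Rightarrow> bool" where
  "indistinguishable \<Phi>\<^sub>1 \<Phi>\<^sub>2 \<longleftrightarrow> graph_property \<Phi>\<^sub>1 \<and> graph_property \<Phi>\<^sub>2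
     \<and> approximable_by \<Phi>\<^sub>1 \<Phi>\<^sub>2 \<and> approximable_by \<Phi>\<^sub>2 \<Phi>\<^sub>1"

end

theory Submission
  imports Defs
begin

text \<open>Some \<open>F \<in> \<F>\<close> has \<open>t = chi\<close> colours and independence number \<open>m = alpha\<close>, so it embeds into
  the complete \<open>t\<close>-partite graph with parts of size \<open>m\<close>: each colour class has at most \<open>m\<close> vertices.
  Hence an \<open>\<F>\<close>-free comparability graph does not contain this complete \<open>t\<close>-partite graph. Two facts
  about a finite poset on \<open>n\<close> elements turn this into the quantitative claim.

  The first is a counting statement (\<open>blowup_if_many_chains\<close>). Let \<open>p\<close> be the proportion of chains
  among the \<open>t\<close>-tuples. Splitting a tuple into its even and its odd coordinates makes
  being a chain a bipartite relation of density \<open>p\<close>; replacing first one side and then the other by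
  \<open>m\<close>-tuples and using convexity of \<open>m\<close>-th powers each time, the blown-up relation has density at least
  \<open>p\<close> to the power \<open>m\<^sup>2\<close>. By transitivity, relations between consecutive parts already force all others,
  so a blown-up chain whose entries within each part are distinct spans a complete \<open>t\<close>-partite graph.
  Tuples with a repeated entry are a proportion below \<open>t\<^sup>2 m\<^sup>2 / n\<close>. It is the use of the path structure,
  blowing up all even and all odd coordinates simultaneously, that gives the exponent \<open>m\<^sup>2\<close> in place of
  the exponent \<open>m ^ t\<close> of a general blow-up.

  The second is a removal lemma for chains (\<open>card_pruned_away\<close>, \<open>many_rich_imp_many_chains\<close>). Fix a
  threshold \<open>s\<close>. Every element is \<open>0\<close>-rich, and an element is \<open>(k+1)\<close>-rich if at least \<open>s\<close> elements above
  it are \<open>k\<close>-rich. Keep \<open>x < y\<close> only if \<open>x\<close> is not \<open>(t-1)\<close>-rich and is strictly richer than \<open>y\<close>. What is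
  kept is transitive, and the richness takes fewer than \<open>t\<close> values on it and properly colours it. An
  element that is not \<open>(t-1)\<close>-rich loses fewer than \<open>s\<close> upper relations, those to elements as rich as
  itself; otherwise it would be richer than it is. If there are at most \<open>s\<close> elements that are
  \<open>(t-1)\<close>-rich, they lose at most \<open>s n\<close> relations in total. So at most \<open>2 s n\<close> edges are removed. If there
  are more, then choosing greedily among rich elements gives at least \<open>s ^ t\<close> chains.

  With \<open>s = \<epsilon> n\<close> the chains have density at least \<open>\<epsilon> ^ t\<close>, and \<open>\<epsilon>\<close> is chosen so that its power with
  exponent \<open>t m\<^sup>2\<close> is \<open>t\<^sup>2 m\<^sup>2 / n\<close>; this contradicts freeness, so the pruning succeeds. The converse
  inclusion is only the monotonicity of the chromatic number under taking subgraphs, and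
  indistinguishability follows since the bound on the removed edges is \<open>o(n\<^sup>2)\<close>.\<close>

section \<open>Blowing up a bipartite relation\<close>

definition words :: "nat \<Rightarrow> 'a set \<Rightarrow> 'a list set" where
  "words k A = {xs. set xs \<subseteq> A \<and> length xs = k}"

lemma finite_words: "finite A \<Longrightarrow> finite (words k A)"
  unfolding words_def by (rule finite_lists_length_eq)

lemma card_words: "finite A \<Longrightarrow> card (words k A) = card A ^ k"
  unfolding words_def by (rule card_lists_length_eq)

lemma nth_words: "xs \<in> words k A \<Longrightarrow> i < k \<Longrightarrow> xs ! i \<in> A"
  by (auto simp: words_def)

lemma update_words: "xs \<in> words k A \<Longrightarrow> a \<in> A \<Longrightarrow> xs[i := a] \<in> words k A"
  unfolding words_def by (auto dest: subsetD[OF set_update_subset_insert])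

text \<open>The right-hand side is convex in \<open>d\<close>, and the left-hand side is its tangent at \<open>a\<close>. Up to scaling
  by \<open>a\<close> this is Bernoulli's inequality.\<close>

lemma power_ge_tangent:
  fixes a d :: real
  assumes "a \<ge> 0" "d \<ge> 0"
  shows "a ^ m + real m * a ^ (m - 1) * (d - a) \<le> d ^ m"
proof (cases "a = 0")
  case True
  consider "m = 0" | "m = 1" | "m \<ge> 2" by linarith
  then show ?thesis using True assms by cases (auto simp: power_0_left)
next
  case False
  then have a: "a > 0" using assms by simp
  have "1 + real m * (d / a - 1) \<le> (1 + (d / a - 1)) ^ m"
    by (rule Bernoulli_inequality) (use a assms in auto)
  then have "a ^ m * (1 + real m * (d / a - 1)) \<le> a ^ m * (d / a) ^ m"
    using a by (intro mult_left_mono) auto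
  also have "a ^ m * (d / a) ^ m = d ^ m"
    using a by (simp flip: power_mult_distrib)
  also have "a ^ m * (1 + real m * (d / a - 1)) = a ^ m + real m * a ^ (m - 1) * (d - a)"
    using a by (cases m) (auto simp: field_simps)
  finally show ?thesis .
qed

text \<open>The power mean inequality, with a lower bound \<open>a\<close> for the mean in place of the mean: summing the
  tangent inequality at \<open>a\<close>, the linear terms have a nonnegative sum.\<close>

lemma sum_power_ge:
  fixes d :: "'x \<Rightarrow> real"
  assumes "finite X" "\<And>x. x \<in> X \<Longrightarrow> d x \<ge> 0" "a \<ge> 0" "real (card X) * a \<le> sum d X"
  shows "real (card X) * a ^ m \<le> (\<Sum>x\<in>X. d x ^ m)"
proof -
  have "real (card X) * a ^ m \<le> real (card X) * a ^ m + real m * a ^ (m - 1) * (sum d X - real (card X) * a)"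
    using assms by simp
  also have "\<dots> = (\<Sum>x\<in>X. a ^ m + real m * a ^ (m - 1) * (d x - a))"
    by (simp add: sum.distrib sum_subtractf flip: sum_distrib_left)
  also have "\<dots> \<le> (\<Sum>x\<in>X. d x ^ m)"
    by (intro sum_mono power_ge_tangent) (use assms in auto)
  finally show ?thesis .
qed

lemma card_related_pairs:
  assumes "finite X" "finite Y"
  shows "card {(x, y). x \<in> X \<and> y \<in> Y \<and> S x y} = (\<Sum>x\<in>X. card {y\<in>Y. S x y})"
proof -
  have "{(x, y). x \<in> X \<and> y \<in> Y \<and> S x y} = (SIGMA x:X. {y\<in>Y. S x y})" by auto
  then show ?thesis using assms by simp
qed

text \<open>Each \<open>x\<close> with \<open>d\<close> neighbours in \<open>Y\<close> extends to \<open>d ^ m\<close> tuples of neighbours, so this is the power mean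
  inequality for the degrees.\<close>

lemma blowup_count:
  fixes p :: real
  assumes fin: "finite X" "finite Y" and "p \<ge> 0"
    and dens: "p * real (card X) * real (card Y) \<le> real (card {(x, y). x \<in> X \<and> y \<in> Y \<and> S x y})"
  shows "p ^ m * real (card X) * real (card (words m Y))
       \<le> real (card {(ys, x). ys \<in> words m Y \<and> x \<in> X \<and> (\<forall>y\<in>set ys. S x y)})"
proof -
  define d where "d x = real (card {y\<in>Y. S x y})" for x
  have "real (card X) * (p * real (card Y)) ^ m \<le> (\<Sum>x\<in>X. d x ^ m)"
  proof (rule sum_power_ge)
    show "real (card X) * (p * real (card Y)) \<le> sum d X"
      using dens by (simp add: card_related_pairs[OF fin] d_def mult_ac)
  qed (use assms in \<open>auto simp: d_def\<close>)
  moreover have "(\<Sum>x\<in>X. d x ^ m)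
      = real (card {(x, ys). x \<in> X \<and> ys \<in> words m Y \<and> (\<forall>y\<in>set ys. S x y)})"
  proof -
    have "d x ^ m = real (card {ys \<in> words m Y. \<forall>y\<in>set ys. S x y})" for x
    proof -
      have "{ys \<in> words m Y. \<forall>y\<in>set ys. S x y} = words m {y\<in>Y. S x y}"
        by (auto simp: words_def)
      then show ?thesis by (simp add: d_def card_words fin)
    qed
    then show ?thesis
      by (simp add: card_related_pairs[OF fin(1) finite_words[OF fin(2)]])
  qed
  moreover have "card {(x, ys). x \<in> X \<and> ys \<in> words m Y \<and> (\<forall>y\<in>set ys. S x y)}
      = card {(ys, x). ys \<in> words m Y \<and> x \<in> X \<and> (\<forall>y\<in>set ys. S x y)}"
    by (rule bij_betw_same_card, rule bij_betw_byWitness[where f = prod.swap and f' = prod.swap]) auto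
  ultimately show ?thesis
    by (simp add: card_words fin power_mult_distrib mult_ac)
qed

text \<open>The blown-up relation between \<open>X\<close> and the \<open>m\<close>-tuples over \<open>Y\<close> is again a bipartite relation, now of
  density \<open>p ^ m\<close>; blowing up its other side raises the density to the \<open>m\<close>-th power once more.\<close>

lemma biclique_blowup_count:
  fixes p :: real
  assumes fin: "finite X" "finite Y" and "p \<ge> 0"
    and dens: "p * real (card X) * real (card Y) \<le> real (card {(x, y). x \<in> X \<and> y \<in> Y \<and> S x y})"
  shows "p ^ (m * m) * real (card (words m X)) * real (card (words m Y))
       \<le> real (card {(xs, ys). xs \<in> words m X \<and> ys \<in> words m Y \<and> (\<forall>x\<in>set xs. \<forall>y\<in>set ys. S x y)})"
proof -
  have "p ^ m * real (card (words m Y)) * real (card X)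
       \<le> real (card {(ys, x). ys \<in> words m Y \<and> x \<in> X \<and> (\<forall>y\<in>set ys. S x y)})"
    using blowup_count[OF assms, of m] by (simp add: mult_ac)
  from blowup_count[OF finite_words[OF fin(2)] fin(1) _ this, of m] \<open>p \<ge> 0\<close>
  show ?thesis by (simp add: power_mult mult_ac)
qed

section \<open>Chains and their even and odd coordinates\<close>

definition mix :: "'a list \<Rightarrow> 'a list \<Rightarrow> 'a list" where
  "mix xs ys = map (\<lambda>i. if even i then xs ! i else ys ! i) [0..<length xs]"

lemma length_mix [simp]: "length (mix xs ys) = length xs"
  by (simp add: mix_def)

lemma nth_mix: "i < length xs \<Longrightarrow> mix xs ys ! i = (if even i then xs ! i else ys ! i)"
  by (simp add: mix_def)

lemma mix_in_words: "xs \<in> words t V \<Longrightarrow> ys \<in> words t V \<Longrightarrow> mix xs ys \<in> words t V"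
  by (auto simp: words_def mix_def split: if_splits)

lemma mix_mix: "length xs = length ys \<Longrightarrow> mix (mix xs ys) (mix ys xs) = xs"
  by (rule nth_equalityI) (auto simp: nth_mix)

lemma mix_mix_words: "xs \<in> words t V \<Longrightarrow> ys \<in> words t V \<Longrightarrow> mix (mix xs ys) (mix ys xs) = xs"
  by (simp add: words_def mix_mix)

text \<open>Mixing with the parities exchanged is an involution on pairs of tuples. So if two tuples are
  drawn independently, one supplying the even and one the odd coordinates, the mixture is uniformly
  distributed. Keeping the superfluous coordinates lets both sides of the bipartite
  relation be the same set of tuples.\<close>

lemma card_mix_pairs:
  assumes "finite V"
  shows "card {(xs, ys). xs \<in> words t V \<and> ys \<in> words t V \<and> Q (mix xs ys)}
       = card {zs \<in> words t V. Q zs} * card (words t V)"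
proof -
  have "bij_betw (\<lambda>(xs, ys). (mix xs ys, mix ys xs))
      {(xs, ys). xs \<in> words t V \<and> ys \<in> words t V \<and> Q (mix xs ys)}
      ({zs \<in> words t V. Q zs} \<times> words t V)"
  proof (rule bij_betw_byWitness[where f' = "\<lambda>(xs, ys). (mix xs ys, mix ys xs)"])
  qed (auto simp: mix_in_words mix_mix_words)
  then show ?thesis
    by (simp add: bij_betw_same_card flip: card_cartesian_product)
qed

text \<open>Overwriting the \<open>i\<close>-th entry of the \<open>j\<close>-th tuple by an arbitrary \<open>v \<in> V\<close> is injective on the families
  with a coincidence at this place, because the lost entry can still be read off from the \<open>k\<close>-th
  tuple.\<close>

lemma card_coincidence:
  assumes "finite V" "i < t" "j < m" "k < m" "j \<noteq> k"
  shows "card {xss \<in> words m (words t V). xss ! j ! i = xss ! k ! i} * card V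
       \<le> card (words m (words t V))"
proof -
  let ?B = "{xss \<in> words m (words t V). xss ! j ! i = xss ! k ! i}"
  define g where "g = (\<lambda>(xss, v :: 'a). xss[j := (xss ! j)[i := v]])"
  have "inj_on g (?B \<times> V)"
  proof (rule inj_onI, clarify)
    fix xss yss :: "'a list list" and v w
    assume x: "xss \<in> words m (words t V)" "xss ! j ! i = xss ! k ! i"
      and y: "yss \<in> words m (words t V)" "yss ! j ! i = yss ! k ! i"
      and eq: "g (xss, v) = g (yss, w)"
    have len: "length xss = m" "length yss = m" using x y by (auto simp: words_def)
    have lj: "length (xss ! j) = t" "length (yss ! j) = t"
      using nth_words[OF x(1) assms(3)] nth_words[OF y(1) assms(3)] by (simp_all add: words_def)
    have eq': "xss[j := (xss ! j)[i := v]] ! l = yss[j := (yss ! j)[i := w]] ! l" for l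
      using eq by (simp add: g_def)
    \<comment> \<open>Away from position \<open>j\<close>, in particular at \<open>k\<close>, nothing is overwritten.\<close>
    have other: "xss ! l = yss ! l" if "l \<noteq> j" for l using eq'[of l] that by simp
    have new: "(xss ! j)[i := v] = (yss ! j)[i := w]"
      using eq'[of j] len assms by simp
    then have eq2: "(xss ! j)[i := v] ! l = (yss ! j)[i := w] ! l" for l by simp
    have "xss ! j ! l = yss ! j ! l" if "l \<noteq> i" for l using eq2[of l] that by simp
    moreover have "xss ! j ! i = yss ! j ! i"
      using x y other[of k] assms by simp
    ultimately have "xss ! j ! l = yss ! j ! l" for l by (cases "l = i") auto
    then have "xss ! j = yss ! j" using lj by (intro nth_equalityI) auto
    then have "xss ! l = yss ! l" for l using other by (cases "l = j") auto
    then have "xss = yss" using len by (intro nth_equalityI) auto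
    moreover have "v = w" using eq2[of i] lj assms by simp
    ultimately show "xss = yss \<and> v = w" by simp
  qed
  moreover have "g ` (?B \<times> V) \<subseteq> words m (words t V)"
  proof clarify
    fix xss v assume "xss \<in> words m (words t V)" "v \<in> V"
    then show "g (xss, v) \<in> words m (words t V)"
      unfolding g_def by (simp add: update_words nth_words[OF _ assms(3)])
  qed
  ultimately have "card (?B \<times> V) \<le> card (words m (words t V))"
    by (intro card_inj_on_le[of g]) (simp_all add: finite_words assms)
  then show ?thesis by (simp add: card_cartesian_product)
qed

section \<open>Many chains contain a blown-up chain\<close>

text \<open>The order relation is confined to \<open>V\<close>, so that irreflexivity and transitivity hold on the whole
  type.\<close>

locale strict_poset =
  fixes V :: "'a set" and R :: "'a \<Rightarrow> 'a \<Rightarrow> bool"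
  assumes fin: "finite V" and irr: "irreflp R" and tr: "transp R"
    and dom: "R x y \<Longrightarrow> x \<in> V" and cod: "R x y \<Longrightarrow> y \<in> V"
begin

definition chains :: "nat \<Rightarrow> 'a list set" where
  "chains t = {xs \<in> words t V. sorted_wrt R xs}"

definition blowup :: "nat \<Rightarrow> nat \<Rightarrow> (nat \<Rightarrow> nat \<Rightarrow> 'a) \<Rightarrow> bool" where
  "blowup t m w \<longleftrightarrow>
     (\<forall>i<t. \<forall>j<m. w i j \<in> V) \<and>
     (\<forall>i<t. inj_on (w i) {..<m}) \<and>
     (\<forall>i i' j j'. i < i' \<longrightarrow> i' < t \<longrightarrow> j < m \<longrightarrow> j' < m \<longrightarrow> R (w i j) (w i' j'))"

text \<open>Parts whose indices have different parity are compared directly by a mixed chain. Two parts of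
  equal parity are compared by transitivity through the part following the smaller one, which has the
  other parity; \<open>m > 0\<close> makes that part nonempty.\<close>

lemma blowup_from_mixed_chains:
  assumes "m > 0"
    and xss: "xss \<in> words m (words t V)" and yss: "yss \<in> words m (words t V)"
    and chain: "\<And>xs ys. xs \<in> set xss \<Longrightarrow> ys \<in> set yss \<Longrightarrow> sorted_wrt R (mix xs ys)"
    and dist: "\<And>i j k. i < t \<Longrightarrow> j < m \<Longrightarrow> k < m \<Longrightarrow> j \<noteq> k \<Longrightarrow>
                 xss ! j ! i \<noteq> xss ! k ! i \<and> yss ! j ! i \<noteq> yss ! k ! i"
  shows "blowup t m (\<lambda>i j. if even i then xss ! j ! i else yss ! j ! i)"
proof -
  define w where "w = (\<lambda>i j. if even i then xss ! j ! i else yss ! j ! i)"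
  have len: "length xss = m" "length yss = m" using xss yss by (auto simp: words_def)
  have xj: "xss ! j \<in> words t V" and yj: "yss ! j \<in> words t V" if "j < m" for j
    using that xss yss nth_words by metis+
  have mixed: "R (mix (xss ! j) (yss ! k) ! i) (mix (xss ! j) (yss ! k) ! i')"
    if "i < i'" "i' < t" "j < m" "k < m" for i i' j k
  proof -
    have "sorted_wrt R (mix (xss ! j) (yss ! k))"
      using chain that len by simp
    then show ?thesis
      using that xj[of j] by (simp add: sorted_wrt_iff_nth_less words_def)
  qed
  have opp: "R (w i j) (w i' k)"
    if "i < i'" "i' < t" "j < m" "k < m" "even i \<noteq> even i'" for i i' j k
    using mixed[of i i' j k] mixed[of i i' k j] that xj[of j] xj[of k]
    by (auto simp: w_def nth_mix words_def split: if_splits)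
  have "R (w i j) (w i' k)" if "i < i'" "i' < t" "j < m" "k < m" for i i' j k
  proof (cases "even i = even i'")
    case True
    with that have "i + 1 < i'" by (metis Suc_eq_plus1 Suc_lessI even_Suc)
    then have "R (w i j) (w (i + 1) 0)" "R (w (i + 1) 0) (w i' k)"
      using opp[of i "i + 1" j 0] opp[of "i + 1" i' 0 k] that True \<open>m > 0\<close> by auto
    then show ?thesis using tr by (metis transpE)
  qed (use opp that in blast)
  moreover have "w i j \<in> V" if "i < t" "j < m" for i j
    using that xj yj nth_words by (metis w_def)
  moreover have "inj_on (w i) {..<m}" if "i < t" for i
    using that dist by (auto simp: inj_on_def w_def)
  ultimately show ?thesis
    unfolding blowup_def w_def[symmetric] by blast
qed

text \<open>A union bound over the places \<open>i\<close> and the ordered pairs \<open>j \<noteq> k\<close>; the excluded diagonal makes the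
  inequality strict.\<close>

lemma card_degenerate:
  assumes "t > 0" "m > 0" "V \<noteq> {}"
  shows "card {xss \<in> words m (words t V). \<exists>i<t. \<exists>j<m. \<exists>k<m. j \<noteq> k \<and> xss ! j ! i = xss ! k ! i} * card V
       < t * m\<^sup>2 * card (words m (words t V))"
proof -
  define W where "W = words m (words t V)"
  define I where "I = {(i, j, k). i < t \<and> j < m \<and> k < m \<and> j \<noteq> k}"
  define B where "B = (\<lambda>(i, j, k). {xss \<in> W. xss ! j ! i = xss ! k ! i})"
  have "I \<subset> {..<t} \<times> {..<m} \<times> {..<m}"
  proof
    have "(0, 0, 0) \<notin> I" "(0, 0, 0) \<in> {..<t} \<times> {..<m} \<times> {..<m}"
      using assms by (auto simp: I_def)
    then show "I \<noteq> {..<t} \<times> {..<m} \<times> {..<m}" by blast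
  qed (auto simp: I_def)
  then have finI: "finite I" and cI: "card I < t * m\<^sup>2"
    using psubset_card_mono[of "{..<t} \<times> {..<m} \<times> {..<m}" I]
    by (auto simp: card_cartesian_product power2_eq_square intro: finite_subset[OF psubset_imp_subset])
  have "card V > 0" using assms fin by (simp add: card_gt_0_iff)
  then have W: "card W > 0" by (simp add: W_def card_words finite_words fin)
  have "card {xss \<in> W. \<exists>i<t. \<exists>j<m. \<exists>k<m. j \<noteq> k \<and> xss ! j ! i = xss ! k ! i} = card (\<Union>x\<in>I. B x)"
    by (rule arg_cong[of _ _ card]) (auto simp: I_def B_def)
  then have "card {xss \<in> W. \<exists>i<t. \<exists>j<m. \<exists>k<m. j \<noteq> k \<and> xss ! j ! i = xss ! k ! i} * card V
      \<le> (\<Sum>x\<in>I. card (B x)) * card V"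
    using card_UN_le[OF finI, of B] by simp
  also have "\<dots> = (\<Sum>x\<in>I. card (B x) * card V)" by (simp add: sum_distrib_right)
  also have "\<dots> \<le> (\<Sum>x\<in>I. card W)"
    by (intro sum_mono) (auto simp: I_def B_def W_def intro!: card_coincidence fin)
  also have "\<dots> < t * m\<^sup>2 * card W" using cI W by simp
  finally show ?thesis by (simp add: W_def)
qed

text \<open>If the density of the mixed chains, raised to the power \<open>m\<^sup>2\<close>, exceeds the proportion of
  degenerate families, some blown-up chain is nondegenerate. Degeneracy may occur on the even or on
  the odd side, whence a factor \<open>2\<close>, which \<open>t\<^sup>2 \<ge> 2 t\<close> absorbs.\<close>

lemma blowup_if_many_chains:
  fixes s :: real
  assumes "t \<ge> 2" "m > 0" "V \<noteq> {}" "s \<ge> 0"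
    and many: "s ^ t \<le> real (card (chains t))"
    and s: "(s / real (card V)) ^ (t * m\<^sup>2) \<ge> real t ^ 2 * real m ^ 2 / real (card V)"
  obtains w where "blowup t m w"
proof -
  define n where "n = real (card V)"
  define W where "W = words m (words t V)"
  define N where "N = real (card W)"
  have n: "n > 0" using assms fin by (simp add: n_def card_gt_0_iff)
  have finw: "finite (words t V)" and finW: "finite W"
    using fin by (simp_all add: W_def finite_words)
  have cw: "real (card (words t V)) = n ^ t" using fin by (simp add: card_words n_def)
  have N: "N = (n ^ t) ^ m"
    unfolding N_def W_def by (simp add: card_words finw cw)
  then have "N > 0" using n by simp
  define Good where "Good = {(xss, yss). xss \<in> W \<and> yss \<in> W \<and>
      (\<forall>xs\<in>set xss. \<forall>ys\<in>set yss. sorted_wrt R (mix xs ys))}"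
  have "((s / n) ^ t) ^ (m * m) * real (card (words m (words t V))) * real (card (words m (words t V)))
      \<le> real (card {(xss, yss). xss \<in> words m (words t V) \<and> yss \<in> words m (words t V) \<and>
          (\<forall>xs\<in>set xss. \<forall>ys\<in>set yss. sorted_wrt R (mix xs ys))})"
  proof (rule biclique_blowup_count[OF finw finw])
    have "card {(xs, ys). xs \<in> words t V \<and> ys \<in> words t V \<and> sorted_wrt R (mix xs ys)}
        = card (chains t) * card (words t V)"
      unfolding chains_def by (rule card_mix_pairs[OF fin])
    then have "real (card {(xs, ys). xs \<in> words t V \<and> ys \<in> words t V \<and> sorted_wrt R (mix xs ys)})
        = real (card (chains t)) * n ^ t" by (simp add: cw)
    moreover have "(s / n) ^ t * n ^ t = s ^ t" using n by (simp flip: power_mult_distrib)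
    ultimately show "(s / n) ^ t * real (card (words t V)) * real (card (words t V))
       \<le> real (card {(xs, ys). xs \<in> words t V \<and> ys \<in> words t V \<and> sorted_wrt R (mix xs ys)})"
      using many n by (simp add: cw)
  qed (use \<open>s \<ge> 0\<close> n in simp)
  then have good: "(s / n) ^ (t * m\<^sup>2) * (N * N) \<le> real (card Good)"
    by (simp add: Good_def W_def N_def power2_eq_square mult_ac flip: power_mult)
  define Bad where "Bad = {xss \<in> W. \<exists>i<t. \<exists>j<m. \<exists>k<m. j \<noteq> k \<and> xss ! j ! i = xss ! k ! i}"
  have finBad: "finite Bad" using finW by (simp add: Bad_def)
  have "real (card Bad) * n < real t * real m ^ 2 * N"
    using card_degenerate[of t m] assms unfolding Bad_def W_def N_def n_def
    by (simp flip: of_nat_mult of_nat_power)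
  then have "2 * (real (card Bad) * N) < 2 * (real t * real m ^ 2 * N / n * N)"
    using n \<open>N > 0\<close> by (simp add: pos_less_divide_eq)
  also have "\<dots> \<le> real t ^ 2 * real m ^ 2 / n * (N * N)"
  proof -
    have "2 * real t \<le> real t ^ 2" using \<open>t \<ge> 2\<close> by (simp add: power2_eq_square)
    then have "2 * real t * (real m ^ 2 * (N * N) / n) \<le> real t ^ 2 * (real m ^ 2 * (N * N) / n)"
      using n by (intro mult_right_mono) auto
    then show ?thesis by (simp add: mult_ac)
  qed
  also have "\<dots> \<le> (s / n) ^ (t * m\<^sup>2) * (N * N)"
    using s by (intro mult_right_mono) (auto simp: n_def)
  also note good
  finally have "2 * (card Bad * card W) < card Good"
    unfolding N_def by (simp flip: of_nat_mult)
  moreover have "card (Bad \<times> W \<union> W \<times> Bad) \<le> 2 * (card Bad * card W)"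
    using card_Un_le[of "Bad \<times> W" "W \<times> Bad"] by (simp add: card_cartesian_product mult.commute)
  ultimately have "\<not> Good \<subseteq> Bad \<times> W \<union> W \<times> Bad"
    using card_mono[of "Bad \<times> W \<union> W \<times> Bad" Good] finBad finW by auto
  then obtain xss yss where "(xss, yss) \<in> Good" "xss \<notin> Bad" "yss \<notin> Bad"
    unfolding Good_def by auto
  have "blowup t m (\<lambda>i j. if even i then xss ! j ! i else yss ! j ! i)"
  proof (rule blowup_from_mixed_chains[OF \<open>m > 0\<close>])
    show "xss ! j ! i \<noteq> xss ! k ! i \<and> yss ! j ! i \<noteq> yss ! k ! i"
      if "i < t" "j < m" "k < m" "j \<noteq> k" for i j k
      using that \<open>(xss, yss) \<in> Good\<close> \<open>xss \<notin> Bad\<close> \<open>yss \<notin> Bad\<close>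
      unfolding Good_def Bad_def by blast
  qed (use \<open>(xss, yss) \<in> Good\<close> in \<open>auto simp: Good_def W_def\<close>)
  then show ?thesis by (rule that)
qed

end

section \<open>Pruning a poset with few chains\<close>

text \<open>One step of the greedy construction of chains: at least \<open>s\<close> choices of the first element, each with
  at least \<open>b\<close> continuations.\<close>

lemma card_Cons_ge:
  fixes b s :: real
  assumes "finite A" "\<And>x. x \<in> A \<Longrightarrow> finite (D x)"
    and "s \<le> real (card A)" "b \<ge> 0" "\<And>x. x \<in> A \<Longrightarrow> b \<le> real (card (D x))"
  shows "s * b \<le> real (card {x # xs | x xs. x \<in> A \<and> xs \<in> D x})"
proof -
  have "{x # xs | x xs. x \<in> A \<and> xs \<in> D x} = (\<lambda>(x, xs). x # xs) ` (SIGMA x:A. D x)"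
    by auto
  moreover have "inj_on (\<lambda>(x, xs). x # xs) (SIGMA x:A. D x)" by (auto simp: inj_on_def)
  ultimately have "card {x # xs | x xs. x \<in> A \<and> xs \<in> D x} = (\<Sum>x\<in>A. card (D x))"
    using assms by (simp add: card_image)
  moreover have "s * b \<le> (\<Sum>x\<in>A. b)" using assms by (simp add: mult_right_mono)
  moreover have "\<dots> \<le> (\<Sum>x\<in>A. real (card (D x)))" using assms by (intro sum_mono) auto
  ultimately show ?thesis by simp
qed

context strict_poset
begin

text \<open>The recursion counts only rich upper neighbours, since these are the ones from which a chain can
  be continued in many ways.\<close>

fun rich :: "real \<Rightarrow> nat \<Rightarrow> 'a \<Rightarrow> bool" where
  "rich s 0 x \<longleftrightarrow> True"
| "rich s (Suc k) x \<longleftrightarrow> s \<le> real (card {y \<in> V. R x y \<and> rich s k y})"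

lemma rich_Suc: "rich s (Suc k) x \<Longrightarrow> rich s k x"
proof (induction k arbitrary: x)
  case (Suc k)
  have "{y \<in> V. R x y \<and> rich s (Suc k) y} \<subseteq> {y \<in> V. R x y \<and> rich s k y}"
    using Suc.IH by blast
  then have "card {y \<in> V. R x y \<and> rich s (Suc k) y} \<le> card {y \<in> V. R x y \<and> rich s k y}"
    using fin by (intro card_mono) auto
  with Suc.prems show ?case by (auto simp del: of_nat_le_iff)
qed simp

lemma rich_antimono: "rich s l x \<Longrightarrow> k \<le> l \<Longrightarrow> rich s k x"
  by (induction l) (auto simp: le_Suc_eq simp del: rich.simps dest: rich_Suc)

text \<open>By transitivity, everything above \<open>y\<close> is above \<open>x\<close>.\<close>

lemma rich_below: "R x y \<Longrightarrow> rich s k y \<Longrightarrow> rich s k x"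
proof (cases k)
  case (Suc l)
  assume xy: "R x y" "rich s k y"
  have "{z \<in> V. R y z \<and> rich s l z} \<subseteq> {z \<in> V. R x z \<and> rich s l z}"
    using xy tr by (blast dest: transpD)
  then have "card {z \<in> V. R y z \<and> rich s l z} \<le> card {z \<in> V. R x z \<and> rich s l z}"
    using fin by (intro card_mono) auto
  with xy Suc show ?thesis by auto
qed simp

text \<open>A \<open>k\<close>-rich element allows at least \<open>s\<close> choices of a \<open>(k-1)\<close>-rich successor, and so on.\<close>

lemma rich_imp_many_chains_above:
  assumes "s \<ge> 0" "rich s k x"
  shows "s ^ k \<le> real (card {xs \<in> words k V. sorted_wrt R (x # xs)})"
  using assms(2)
proof (induction k arbitrary: x)
  case 0
  have "{xs \<in> words 0 V. sorted_wrt R (x # xs)} = {[]}" by (auto simp: words_def)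
  then show ?case by simp
next
  case (Suc k)
  have "s * s ^ k \<le> real (card {y # xs | y xs. y \<in> {y \<in> V. R x y \<and> rich s k y} \<and>
      xs \<in> {xs \<in> words k V. sorted_wrt R (y # xs)}})"
    using Suc \<open>s \<ge> 0\<close> fin by (intro card_Cons_ge) (auto simp: finite_words)
  also have "\<dots> \<le> real (card {xs \<in> words (Suc k) V. sorted_wrt R (x # xs)})"
  proof (intro of_nat_mono card_mono subsetI)
    show "finite {xs \<in> words (Suc k) V. sorted_wrt R (x # xs)}"
      using fin by (simp add: finite_words)
  qed (auto simp: words_def sorted_wrt2[OF tr] simp del: sorted_wrt.simps)
  finally show ?case by simp
qed

lemma many_rich_imp_many_chains:
  assumes "s \<ge> 0" "s \<le> real (card {x \<in> V. rich s k x})"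
  shows "s ^ Suc k \<le> real (card (chains (Suc k)))"
proof -
  have "s * s ^ k \<le> real (card {y # xs | y xs. y \<in> {x \<in> V. rich s k x} \<and>
      xs \<in> {xs \<in> words k V. sorted_wrt R (y # xs)}})"
    using assms fin rich_imp_many_chains_above
    by (intro card_Cons_ge) (auto simp: finite_words)
  also have "\<dots> \<le> real (card (chains (Suc k)))"
  proof (intro of_nat_mono card_mono subsetI)
    show "finite (chains (Suc k))"
      using fin by (simp add: chains_def finite_words)
  qed (auto simp: chains_def words_def)
  finally show ?thesis by simp
qed

text \<open>The witness \<open>k\<close> says that \<open>x\<close> is strictly richer than \<open>y\<close>; comparing richness in this way makes
  transitivity immediate.\<close>

definition pruned :: "real \<Rightarrow> nat \<Rightarrow> 'a \<Rightarrow> 'a \<Rightarrow> bool" where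
  "pruned s h x y \<longleftrightarrow> R x y \<and> \<not> rich s h x \<and> (\<exists>k. rich s k x \<and> \<not> rich s k y)"

lemma transp_pruned: "transp (pruned s h)"
proof (rule transpI)
  fix x y z assume "pruned s h x y" "pruned s h y z"
  then show "pruned s h x z"
    unfolding pruned_def using tr rich_below by (metis transpE)
qed

text \<open>The largest \<open>k\<close> for which \<open>x\<close> is \<open>k\<close>-rich, provided that it is less than \<open>h\<close>. The \<open>h\<close>-rich elements lose
  all their relations, upper ones by definition of \<^const>\<open>pruned\<close> and lower ones because every element
  below them is \<open>h\<close>-rich too, so they can share the colour \<open>0\<close>.\<close>

definition level :: "real \<Rightarrow> nat \<Rightarrow> 'a \<Rightarrow> nat" where
  "level s h x = (if rich s h x then 0 else LEAST k. \<not> rich s (Suc k) x)"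

lemma level_poor:
  assumes "\<not> rich s h x"
  shows "level s h x < h" "rich s k x \<longleftrightarrow> k \<le> level s h x"
proof -
  have h: "h > 0" using assms by (cases h) auto
  then have "\<not> rich s (Suc (h - 1)) x" using assms by simp
  then have "(LEAST k. \<not> rich s (Suc k) x) \<le> h - 1" and "\<not> rich s (Suc (LEAST k. \<not> rich s (Suc k) x)) x"
    by (rule Least_le, rule LeastI)
  then have 1: "\<not> rich s (Suc (level s h x)) x" and 2: "level s h x < h"
    using assms h by (auto simp: level_def)
  show "level s h x < h" by (fact 2)
  have "rich s (level s h x) x"
  proof (cases "level s h x")
    case (Suc l)
    then have "l < (LEAST k. \<not> rich s (Suc k) x)" using assms by (simp add: level_def)
    then show ?thesis using not_less_Least[of l "\<lambda>k. \<not> rich s (Suc k) x"] Suc by simp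
  qed simp
  then have "rich s k x" if "k \<le> level s h x" using that by (rule rich_antimono)
  moreover have "k \<le> level s h x" if "rich s k x"
  proof (rule ccontr)
    assume "\<not> k \<le> level s h x"
    then have "Suc (level s h x) \<le> k" by simp
    from rich_antimono[OF that this] 1 show False by contradiction
  qed
  ultimately show "rich s k x \<longleftrightarrow> k \<le> level s h x" by blast
qed

lemma level_less: "h > 0 \<Longrightarrow> level s h x < h"
  using level_poor(1) by (cases "rich s h x") (auto simp: level_def)

lemma pruned_level: "pruned s h x y \<Longrightarrow> level s h y < level s h x"
proof -
  assume "pruned s h x y"
  then obtain k where k: "R x y" "\<not> rich s h x" "rich s k x" "\<not> rich s k y"
    unfolding pruned_def by blast
  then have "\<not> rich s h y" using rich_below by blast
  then show ?thesis
    using k level_poor(2)[of s h x k] level_poor(2)[of s h y k] by simp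
qed

text \<open>The relations lost at an \<open>h\<close>-rich element are counted by \<open>?A\<close>. An element \<open>x\<close> that is not \<open>h\<close>-rich loses
  only relations to elements at least as rich as \<open>x\<close> itself, and there are fewer than \<open>s\<close> of them, since
  otherwise \<open>x\<close> would be richer.\<close>

lemma card_pruned_away:
  assumes "s \<ge> 0" "real (card {x \<in> V. rich s h x}) \<le> s"
  shows "real (card {(x, y). R x y \<and> \<not> pruned s h x y}) \<le> 2 * s * real (card V)"
proof -
  let ?D = "{(x, y). R x y \<and> \<not> pruned s h x y}"
  let ?A = "{x \<in> V. rich s h x} \<times> V"
  let ?N = "\<lambda>x. {y \<in> V. R x y \<and> rich s (level s h x) y}"
  let ?B = "SIGMA x:{x \<in> V. \<not> rich s h x}. ?N x"
  have "?D \<subseteq> ?A \<union> ?B"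
  proof
    fix e assume "e \<in> ?D"
    then obtain x y where e: "e = (x, y)" and xy: "R x y" "\<not> pruned s h x y" by blast
    show "e \<in> ?A \<union> ?B"
    proof (cases "rich s h x")
      case True
      with e xy dom cod show ?thesis by blast
    next
      case False
      then have "rich s (level s h x) x" using level_poor(2) by blast
      with xy False have "rich s (level s h x) y" unfolding pruned_def by blast
      with e xy False dom cod show ?thesis by blast
    qed
  qed
  moreover have "finite ?A" "finite ?B" using fin by auto
  ultimately have "card ?D \<le> card ?A + card ?B"
    using card_mono[of "?A \<union> ?B" ?D] card_Un_le[of ?A ?B] by (meson finite_UnI le_trans)
  then have "real (card ?D) \<le> real (card ?A) + real (card ?B)" by linarith
  also have "real (card ?A) \<le> s * real (card V)"
    using assms by (simp add: card_cartesian_product mult_right_mono)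
  also have "real (card ?B) = (\<Sum>x\<in>{x \<in> V. \<not> rich s h x}. real (card (?N x)))"
    using fin by simp
  also have "\<dots> \<le> (\<Sum>x\<in>{x \<in> V. \<not> rich s h x}. s)"
  proof (rule sum_mono)
    fix x assume "x \<in> {x \<in> V. \<not> rich s h x}"
    then have "\<not> rich s (Suc (level s h x)) x"
      using level_poor(2)[of s h x] by (simp del: rich.simps)
    then show "real (card (?N x)) \<le> s" by simp
  qed
  also have "\<dots> \<le> s * real (card V)"
    using fin \<open>s \<ge> 0\<close> by (simp add: mult.commute mult_left_mono card_mono)
  finally show ?thesis by simp
qed

end

section \<open>Comparability graphs as strict posets\<close>

text \<open>Restricting an order on the vertex set to that set does not change its comparability graph.\<close>

lemma comparability_graph_iff:
  "comparability_graph G \<longleftrightarrow>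
     (\<exists>R. strict_poset (verts G) R \<and> edges G = {{x, y} | x y. R x y})"
proof
  assume "comparability_graph G"
  then obtain R where fin: "finite (verts G)" and R: "irreflp_on (verts G) R" "transp_on (verts G) R"
    and G: "G = comparability_graph_of (verts G) R"
    unfolding comparability_graph_def by blast
  define R' where "R' x y \<longleftrightarrow> x \<in> verts G \<and> y \<in> verts G \<and> R x y" for x y
  have "strict_poset (verts G) R'"
  proof
    show "transp R'"
      by (rule transpI) (use R(2) in \<open>auto simp: R'_def dest: transp_onD\<close>)
  qed (use fin R(1) in \<open>auto simp: R'_def irreflp_on_def\<close>)
  moreover have "edges G = edges (comparability_graph_of (verts G) R)"
    using G by (rule arg_cong)
  then have "edges G = {{x, y} | x y. R' x y}"
    unfolding comparability_graph_of_def R'_def by (auto simp: insert_commute)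
  ultimately show "\<exists>R. strict_poset (verts G) R \<and> edges G = {{x, y} | x y. R x y}" by blast
next
  assume "\<exists>R. strict_poset (verts G) R \<and> edges G = {{x, y} | x y. R x y}"
  then obtain R where "strict_poset (verts G) R" and E: "edges G = {{x, y} | x y. R x y}" by blast
  then interpret strict_poset "verts G" R by simp
  have "edges G = {{x, y} | x y. x \<in> verts G \<and> y \<in> verts G \<and> (R x y \<or> R y x)}"
    unfolding E using dom cod by (blast intro: insert_commute)
  then have "G = comparability_graph_of (verts G) R"
    by (simp add: comparability_graph_of_def prod_eq_iff)
  then show "comparability_graph G"
    unfolding comparability_graph_def
    using fin irreflp_on_subset[OF irr subset_UNIV] transp_on_subset[OF tr subset_UNIV] by blast
qed

lemma fin_graph_comparability_graph: "comparability_graph G \<Longrightarrow> fin_graph G"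
proof -
  assume "comparability_graph G"
  then obtain R where "strict_poset (verts G) R" and E: "edges G = {{x, y} | x y. R x y}"
    by (auto simp: comparability_graph_iff)
  then interpret strict_poset "verts G" R by simp
  have "x \<in> verts G \<and> y \<in> verts G \<and> x \<noteq> y" if "R x y" for x y
    using that dom cod irr by (auto simp: irreflp_on_def)
  then have "edges G \<subseteq> [verts G]\<^bsup>2\<^esup>" unfolding E by auto
  with fin show ?thesis by (simp add: fin_graph_def)
qed

lemma fin_graph_edge: "fin_graph G \<Longrightarrow> {x, y} \<in> edges G \<Longrightarrow> x \<in> verts G \<and> y \<in> verts G \<and> x \<noteq> y"
  unfolding fin_graph_def using doubleton_in_nsets_2[of x y "verts G"] by blast

section \<open>Colourings and complete multipartite graphs\<close>

lemma chromatic_number_le: "proper_coloring G k c \<Longrightarrow> chromatic_number G \<le> k"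
  unfolding chromatic_number_def by (rule Least_le) blast

lemma proper_coloring_chromatic_number:
  assumes "fin_graph G"
  obtains c where "proper_coloring G (chromatic_number G) c"
proof -
  obtain f and n :: nat where f: "f ` verts G = {i. i < n}" "inj_on f (verts G)"
    using assms finite_imp_inj_to_nat_seg[of "verts G"] unfolding fin_graph_def by auto
  have "f x \<noteq> f y" if "{x, y} \<in> edges G" for x y
    using fin_graph_edge[OF assms that] f(2) by (simp add: inj_on_eq_iff)
  then have "proper_coloring G n f" using f(1) by (simp add: proper_coloring_def lessThan_def)
  then have "\<exists>c. proper_coloring G n c" by blast
  then have "\<exists>c. proper_coloring G (chromatic_number G) c"
    unfolding chromatic_number_def by (rule LeastI)
  then show ?thesis using that by blast
qed

lemma chromatic_number_copy_le:
  assumes "fin_graph G" "subgraph H G" "isomorphic F H"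
  shows "chromatic_number F \<le> chromatic_number G"
proof -
  obtain c where c: "proper_coloring G (chromatic_number G) c"
    using proper_coloring_chromatic_number assms by blast
  obtain f where f: "bij_betw f (verts F) (verts H)" "edges H = (`) f ` edges F"
    using assms by (auto simp: isomorphic_def)
  have "{f x, f y} \<in> edges G" if "{x, y} \<in> edges F" for x y
  proof -
    have "f ` {x, y} \<in> edges H" unfolding f(2) using that by (rule imageI)
    then show ?thesis using assms by (auto simp: subgraph_def)
  qed
  moreover have "f ` verts F \<subseteq> verts G"
    using f assms by (auto simp: subgraph_def bij_betw_def)
  ultimately have "proper_coloring F (chromatic_number G) (c \<circ> f)"
    using c unfolding proper_coloring_def by (simp add: image_subset_iff)
  then show ?thesis by (rule chromatic_number_le)
qed

lemma card_le_independence_number: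
  assumes "fin_graph G" "S \<subseteq> verts G" "indep S (edges G)"
  shows "card S \<le> independence_number G"
proof -
  have "finite {card S | S. S \<subseteq> verts G \<and> indep S (edges G)}"
    by (rule finite_subset[of _ "card ` Pow (verts G)"])
       (use assms in \<open>auto simp: fin_graph_def\<close>)
  then show ?thesis
    unfolding independence_number_def using assms by (intro Max_ge) auto
qed

lemma card_color_class_le:
  assumes "fin_graph G" "proper_coloring G k c"
  shows "card {v \<in> verts G. c v = i} \<le> independence_number G"
proof (rule card_le_independence_number[OF assms(1)])
  show "indep {v \<in> verts G. c v = i} (edges G)"
    unfolding indep_def
  proof (intro ballI impI notI)
    fix v w assume vw: "v \<in> {v \<in> verts G. c v = i}" "w \<in> {v \<in> verts G. c v = i}"
    assume "{v, w} \<in> edges G"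
    then have "c v \<noteq> c w" using assms(2) by (simp add: proper_coloring_def)
    with vw show False by simp
  qed
qed blast

lemma independence_number_pos:
  assumes "fin_graph G" "chromatic_number G > 0"
  shows "independence_number G > 0"
proof -
  have "verts G \<noteq> {}"
  proof
    assume "verts G = {}"
    then have "proper_coloring G 0 (\<lambda>_. 0)"
      using fin_graph_edge[OF assms(1)] by (auto simp: proper_coloring_def)
    then have "chromatic_number G \<le> 0" by (rule chromatic_number_le)
    then show False using assms(2) by simp
  qed
  then obtain v where "v \<in> verts G" by blast
  then have "card {v} \<le> independence_number G"
    using assms by (intro card_le_independence_number) (auto simp: indep_def)
  then show ?thesis by simp
qed

text \<open>Send the colour classes of \<open>F\<close> injectively into the corresponding parts. Only edges of \<open>G\<close> between
  different parts are used, and \<open>G\<close> may have further edges within a part, as the copy need not be induced.\<close>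

lemma complete_multipartite_contains:
  assumes F: "fin_graph F" "proper_coloring F t c" "\<And>i. card {v \<in> verts F. c v = i} \<le> m"
    and G: "fin_graph G"
    and inj: "\<And>i. i < t \<Longrightarrow> inj_on (w i) {..<m}"
    and edge: "\<And>i i' j j'. i < t \<Longrightarrow> i' < t \<Longrightarrow> j < m \<Longrightarrow> j' < m \<Longrightarrow> i \<noteq> i' \<Longrightarrow>
                {w i j, w i' j'} \<in> edges G"
    and vert: "\<And>i j. i < t \<Longrightarrow> j < m \<Longrightarrow> w i j \<in> verts G"
  shows "\<exists>H. subgraph H G \<and> isomorphic F H"
proof -
  have "\<exists>g. g ` {v \<in> verts F. c v = i} \<subseteq> {..<m} \<and> inj_on g {v \<in> verts F. c v = i}" for i
    using F(1) F(3)[of i] by (intro card_le_inj) (simp_all add: fin_graph_def)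
  then have "\<forall>i. \<exists>g. g ` {v \<in> verts F. c v = i} \<subseteq> {..<m} \<and> inj_on g {v \<in> verts F. c v = i}"
    by blast
  from choice[OF this] obtain g where g: "\<And>i. g i ` {v \<in> verts F. c v = i} \<subseteq> {..<m}"
      "\<And>i. inj_on (g i) {v \<in> verts F. c v = i}"
    by blast
  define f where "f v = w (c v) (g (c v) v)" for v
  have ct: "c v < t" and gm: "g (c v) v < m" if "v \<in> verts F" for v
    using that F(2) g(1)[of "c v"] unfolding proper_coloring_def by blast+
  have f_edge: "{f x, f y} \<in> edges G" if "x \<in> verts F" "y \<in> verts F" "c x \<noteq> c y" for x y
    unfolding f_def using that ct gm by (intro edge) auto
  have f_inj: "inj_on f (verts F)"
  proof (rule inj_onI)
    fix x y assume xy: "x \<in> verts F" "y \<in> verts F" "f x = f y"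
    then have cxy: "c x = c y"
      using f_edge[of x y] fin_graph_edge[OF G, of "f x" "f y"] by blast
    then have "w (c x) (g (c x) x) = w (c x) (g (c x) y)" using xy(3) by (simp add: f_def)
    then have "g (c x) x = g (c x) y"
      using inj_onD[OF inj[OF ct[OF xy(1)]]] gm[OF xy(1)] gm[OF xy(2)] cxy by simp
    then show "x = y" using inj_onD[OF g(2)[of "c x"]] xy(1,2) cxy by simp
  qed
  define H where "H = (f ` verts F, (`) f ` edges F)"
  have edge2: "\<exists>x y. e = {x, y} \<and> x \<in> verts F \<and> y \<in> verts F \<and> c x \<noteq> c y" if e: "e \<in> edges F" for e
  proof -
    have "e \<in> [verts F]\<^bsup>2\<^esup>" using e F(1) by (auto simp: fin_graph_def)
    then obtain x y where "e = {x, y}" "x \<in> verts F" "y \<in> verts F" by (rule nsets2_E)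
    moreover from this have "c x \<noteq> c y" using e F(2) by (simp add: proper_coloring_def)
    ultimately show ?thesis by blast
  qed
  have EH: "edges H \<subseteq> edges G"
  proof
    fix e' assume "e' \<in> edges H"
    then obtain e where "e \<in> edges F" "e' = f ` e" by (auto simp: H_def)
    then show "e' \<in> edges G" using edge2[of e] f_edge by auto
  qed
  have "edges H \<subseteq> [verts H]\<^bsup>2\<^esup>"
  proof
    fix e' assume e': "e' \<in> edges H"
    then obtain e where "e \<in> edges F" "e' = f ` e" by (auto simp: H_def)
    then obtain x y where xy: "e' = {f x, f y}" "x \<in> verts F" "y \<in> verts F"
      using edge2[of e] by auto
    then have "f x \<noteq> f y" using e' EH fin_graph_edge[OF G] by blast
    with xy show "e' \<in> [verts H]\<^bsup>2\<^esup>" by (simp add: H_def)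
  qed
  moreover have "verts H \<subseteq> verts G"
    using vert ct gm by (auto simp: H_def f_def)
  moreover have "finite (verts H)" using F(1) by (simp add: H_def fin_graph_def)
  ultimately have "subgraph H G" using EH G by (simp add: subgraph_def fin_graph_def)
  moreover have "isomorphic F H"
    unfolding isomorphic_def H_def using f_inj by (auto intro: inj_on_imp_bij_betw)
  ultimately show ?thesis by blast
qed

section \<open>Invariance under isomorphism\<close>

lemma isomorphic_trans:
  assumes "isomorphic F G" "isomorphic G H"
  shows "isomorphic F H"
proof -
  obtain f where f: "bij_betw f (verts F) (verts G)" "edges G = (`) f ` edges F"
    using assms(1) by (auto simp: isomorphic_def)
  obtain g where g: "bij_betw g (verts G) (verts H)" "edges H = (`) g ` edges G"
    using assms(2) by (auto simp: isomorphic_def)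
  have "edges H = (`) (g \<circ> f) ` edges F"
    unfolding g(2) f(2) by (simp only: image_image o_def)
  with bij_betw_trans[OF f(1) g(1)] show ?thesis
    unfolding isomorphic_def by (intro exI[of _ "g \<circ> f"] conjI)
qed

lemma isomorphic_sym:
  assumes "fin_graph G" "isomorphic G H"
  shows "isomorphic H G"
proof -
  obtain f where f: "bij_betw f (verts G) (verts H)" "edges H = (`) f ` edges G"
    using assms by (auto simp: isomorphic_def)
  let ?g = "inv_into (verts G) f"
  have cancel: "?g ` f ` e = e" if "e \<in> edges G" for e
  proof -
    have "e \<subseteq> verts G" using that assms(1) by (auto simp: fin_graph_def nsets_def)
    with f(1) show ?thesis unfolding bij_betw_def by (intro inv_into_image_cancel) blast+
  qed
  have "(`) ?g ` edges H = (\<lambda>e. ?g ` f ` e) ` edges G" unfolding f(2) by (rule image_image)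
  also have "\<dots> = edges G" using cancel by simp
  finally have "edges G = (`) ?g ` edges H" by (rule sym)
  with bij_betw_inv_into[OF f(1)] show ?thesis
    unfolding isomorphic_def by (intro exI[of _ ?g] conjI)
qed

lemma isomorphic_subgraph:
  assumes "isomorphic H G" "subgraph H' H" "fin_graph G"
  shows "\<exists>G'. subgraph G' G \<and> isomorphic H' G'"
proof -
  obtain f where f: "bij_betw f (verts H) (verts G)" "edges G = (`) f ` edges H"
    using assms by (auto simp: isomorphic_def)
  have inj: "inj_on f (verts H')"
    using f(1) assms(2) by (auto simp: bij_betw_def subgraph_def intro: inj_on_subset)
  define G' where "G' = (f ` verts H', (`) f ` edges H')"
  have "f ` e \<in> [f ` verts H']\<^bsup>2\<^esup>" if "e \<in> edges H'" for e
  proof -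
    have "e \<in> [verts H']\<^bsup>2\<^esup>" using that assms(2) by (auto simp: subgraph_def fin_graph_def)
    then obtain x y where "e = {x, y}" "x \<in> verts H'" "y \<in> verts H'" "x \<noteq> y" by (rule nsets2_E)
    then show ?thesis using inj by (auto simp: inj_on_def)
  qed
  then have "edges G' \<subseteq> [verts G']\<^bsup>2\<^esup>" by (auto simp: G'_def)
  moreover have "f ` verts H = verts G" "verts H' \<subseteq> verts H" "edges H' \<subseteq> edges H"
    using f assms(2) by (simp_all add: subgraph_def bij_betw_def)
  then have "verts G' \<subseteq> verts G" "edges G' \<subseteq> edges G"
    using f(2) by (auto simp: G'_def)
  ultimately have "subgraph G' G"
    using assms by (auto simp: subgraph_def fin_graph_def G'_def)
  moreover have "isomorphic H' G'"
    unfolding isomorphic_def G'_def using inj by (auto intro: inj_on_imp_bij_betw)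
  ultimately show ?thesis by blast
qed

lemma subgraph_refl: "fin_graph G \<Longrightarrow> subgraph G G"
  by (simp add: subgraph_def)

lemma comparability_graph_isomorphic:
  assumes "comparability_graph G" "isomorphic G H"
  shows "comparability_graph H"
proof -
  obtain R where "strict_poset (verts G) R" and E: "edges G = {{x, y} | x y. R x y}"
    using assms by (auto simp: comparability_graph_iff)
  then interpret strict_poset "verts G" R by simp
  obtain f where f: "bij_betw f (verts G) (verts H)" "edges H = (`) f ` edges G"
    using assms by (auto simp: isomorphic_def)
  define R' where "R' u v \<longleftrightarrow> (\<exists>x y. R x y \<and> u = f x \<and> v = f y)" for u v
  have inj: "f x = f y \<longleftrightarrow> x = y" if "x \<in> verts G" "y \<in> verts G" for x y
    using f(1) that by (auto simp: bij_betw_def inj_on_def)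
  have "strict_poset (verts H) R'"
  proof
    show "finite (verts H)" using f(1) fin bij_betw_finite by blast
    show "irreflp R'"
      using irr inj dom cod by (auto simp: irreflp_on_def R'_def)
    show "transp R'"
    proof (rule transpI)
      fix u v w assume "R' u v" "R' v w"
      then obtain x y y' z where *: "R x y" "u = f x" "v = f y" "R y' z" "v = f y'" "w = f z"
        unfolding R'_def by blast
      then have "y = y'" using inj dom cod by metis
      then show "R' u w" using * transpD[OF tr, of x y z] unfolding R'_def by blast
    qed
  qed (use f(1) dom cod in \<open>auto simp: R'_def bij_betw_def\<close>)
  moreover have "edges H = {{u, v} | u v. R' u v}"
  proof -
    have "edges H = {f ` {x, y} | x y. R x y}" unfolding f(2) E by blast
    then show ?thesis unfolding R'_def by auto
  qed
  ultimately show ?thesis unfolding comparability_graph_iff by blast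
qed

lemma family_free_isomorphic:
  assumes "fin_graph G" "family_free \<F> G" "fin_graph H" "isomorphic G H"
  shows "family_free \<F> H"
  unfolding family_free_def
proof
  assume "\<exists>F\<in>\<F>. \<exists>H'. subgraph H' H \<and> isomorphic F H'"
  then obtain F H' where F: "F \<in> \<F>" "subgraph H' H" "isomorphic F H'" by blast
  then obtain G' where "subgraph G' G" "isomorphic H' G'"
    using isomorphic_subgraph[OF isomorphic_sym[OF assms(1,4)]] assms(1) by blast
  then show False using F isomorphic_trans assms(2) unfolding family_free_def by blast
qed

lemma family_attained:
  assumes "\<F> \<noteq> {}"
  obtains F where "F \<in> \<F>" "chromatic_number F = family_chi \<F>"
    "independence_number F = family_alpha \<F>"
proof -
  have "family_chi \<F> \<in> chromatic_number ` \<F>"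
    unfolding family_chi_def using assms by (intro Inf_nat_def1) auto
  then have "{F \<in> \<F>. chromatic_number F = family_chi \<F>} \<noteq> {}" by force
  then have "family_alpha \<F> \<in> independence_number ` {F \<in> \<F>. chromatic_number F = family_chi \<F>}"
    unfolding family_alpha_def by (intro Inf_nat_def1) auto
  then show ?thesis using that by force
qed

lemma family_chi_le: "F \<in> \<F> \<Longrightarrow> family_chi \<F> \<le> chromatic_number F"
  unfolding family_chi_def by (rule cINF_lower) auto

section \<open>Removing edges from a free comparability graph\<close>

text \<open>The threshold is \<open>s = \<epsilon> n\<close> with \<open>\<epsilon>\<close> the quantity in the bound. Were more than \<open>s\<close> elements
  \<open>(t-1)\<close>-rich, the poset would have \<open>s ^ t\<close> chains of \<open>t\<close> elements, hence a blown-up chain and a copy of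
  \<open>F\<close>. So the pruned order has a small defect, and its comparability graph is coloured by the level.\<close>

lemma prune_comparability_graph:
  fixes G :: "'a graph" and F :: "'b graph"
  assumes G: "comparability_graph G" and F: "fin_graph F"
    and t: "t = chromatic_number F" "t \<ge> 2" and m: "m = independence_number F"
    and free: "\<not> (\<exists>H. subgraph H G \<and> isomorphic F H)"
  defines "n \<equiv> real (card (verts G))"
  shows "\<exists>G'. spanning_subgraph G' G \<and> comparability_graph G' \<and> chromatic_number G' \<le> t - 1 \<and>
    real (card (edges G - edges G'))
      \<le> 2 * ((real t ^ 2 * real m ^ 2 / n) powr (1 / (real t * real m ^ 2))) * n ^ 2"
proof (cases "verts G = {}")
  case True
  then have "edges G = {}" 
    using fin_graph_comparability_graph[OF G] by (auto simp: fin_graph_def nsets_def)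
  then have "proper_coloring G (t - 1) (\<lambda>_. 0)"
    using True by (simp add: proper_coloring_def)
  then have "chromatic_number G \<le> t - 1" by (rule chromatic_number_le)
  then show ?thesis
    using G subgraph_refl[OF fin_graph_comparability_graph[OF G]]
    by (intro exI[of _ G]) (simp add: spanning_subgraph_def n_def)
next
  case False
  obtain R where sp: "strict_poset (verts G) R" and E: "edges G = {{x, y} | x y. R x y}"
    using G by (auto simp: comparability_graph_iff)
  interpret strict_poset "verts G" R by (fact sp)
  have "m > 0" using independence_number_pos[OF F] t m by simp
  have "n > 0" using False fin by (simp add: n_def card_gt_0_iff)
  define q where "q = real t ^ 2 * real m ^ 2 / n"
  define \<epsilon> where "\<epsilon> = q powr (1 / (real t * real m ^ 2))"
  define s where "s = \<epsilon> * n"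
  have "q > 0" using \<open>m > 0\<close> \<open>n > 0\<close> t by (simp add: q_def)
  then have "\<epsilon> > 0" by (simp add: \<epsilon>_def)
  then have "s \<ge> 0" using \<open>n > 0\<close> by (simp add: s_def)
  have pow: "(s / n) ^ (t * m\<^sup>2) = q"
  proof -
    have "(s / n) ^ (t * m\<^sup>2) = \<epsilon> powr real (t * m\<^sup>2)"
      using \<open>\<epsilon> > 0\<close> \<open>n > 0\<close> by (simp add: s_def powr_realpow del: of_nat_mult of_nat_power)
    also have "\<dots> = q powr (1 / (real t * real m ^ 2) * real (t * m\<^sup>2))"
      unfolding \<epsilon>_def by (rule powr_powr)
    also have "\<dots> = q" using \<open>q > 0\<close> \<open>m > 0\<close> t by simp
    finally show ?thesis .
  qed
  have few: "real (card {x \<in> verts G. rich s (t - 1) x}) \<le> s"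
  proof (rule ccontr)
    assume "\<not> ?thesis"
    then have "s ^ Suc (t - 1) \<le> real (card (chains (Suc (t - 1))))"
      using many_rich_imp_many_chains[OF \<open>s \<ge> 0\<close>] by simp
    then have "s ^ t \<le> real (card (chains t))" using t by simp
    then obtain w where w: "blowup t m w"
      using blowup_if_many_chains[OF \<open>t \<ge> 2\<close> \<open>m > 0\<close> False \<open>s \<ge> 0\<close>] pow
      by (auto simp: q_def n_def)
    obtain c where c: "proper_coloring F t c"
      using proper_coloring_chromatic_number[OF F] t by blast
    have "\<exists>H. subgraph H G \<and> isomorphic F H"
    proof (rule complete_multipartite_contains[OF F c])
      show "{w i j, w i' j'} \<in> edges G"
        if "i < t" "i' < t" "j < m" "j' < m" "i \<noteq> i'" for i i' j j'
      proof -
        have "R (w i j) (w i' j') \<or> R (w i' j') (w i j)"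
          using that w unfolding blowup_def by (metis nat_neq_iff)
        then show ?thesis unfolding E by (auto simp: insert_commute)
      qed
    qed (use w c card_color_class_le[OF F c] fin_graph_comparability_graph[OF G] m
         in \<open>auto simp: blowup_def\<close>)
    then show False using free by contradiction
  qed
  define G' where "G' = (verts G, {{x, y} | x y. pruned s (t - 1) x y})"
  have "strict_poset (verts G) (pruned s (t - 1))"
    by standard (use fin irr transp_pruned dom cod in \<open>auto simp: pruned_def irreflp_on_def\<close>)
  then have G': "comparability_graph G'"
    unfolding comparability_graph_iff G'_def by auto
  have "edges G' \<subseteq> edges G" unfolding E G'_def by (auto simp: pruned_def)
  then have "spanning_subgraph G' G"
    using fin_graph_comparability_graph[OF G] fin_graph_comparability_graph[OF G']
    by (simp add: spanning_subgraph_def subgraph_def) (simp add: G'_def)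
  moreover have "proper_coloring G' (t - 1) (level s (t - 1))"
    using level_less[of "t - 1" s] t
    by (auto simp: proper_coloring_def G'_def doubleton_eq_iff dest: pruned_level)
  then have "chromatic_number G' \<le> t - 1" by (rule chromatic_number_le)
  moreover have "real (card (edges G - edges G')) \<le> 2 * \<epsilon> * n ^ 2"
  proof -
    let ?D = "{(x, y). R x y \<and> \<not> pruned s (t - 1) x y}"
    have "finite ?D"
      by (rule finite_subset[of _ "verts G \<times> verts G"]) (use fin dom cod in auto)
    moreover have "edges G - edges G' \<subseteq> (\<lambda>(x, y). {x, y}) ` ?D"
      unfolding E G'_def by auto
    ultimately have "card (edges G - edges G') \<le> card ?D"
      by (rule surj_card_le)
    then have "real (card (edges G - edges G')) \<le> real (card ?D)" by simp
    also have "\<dots> \<le> 2 * s * n"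
      using card_pruned_away[OF \<open>s \<ge> 0\<close> few] by (simp add: n_def)
    finally show ?thesis by (simp add: s_def power2_eq_square)
  qed
  ultimately show ?thesis using G' unfolding \<epsilon>_def q_def by blast
qed

text \<open>The base \<open>C / n\<close> tends to \<open>0\<close> and the exponent is positive.\<close>

lemma powr_bound_eventually_small:
  fixes C \<delta> \<epsilon> :: real
  assumes "C \<ge> 0" "\<delta> > 0" "\<epsilon> > 0"
  shows "\<exists>N. \<forall>n\<ge>N. 2 * (C / real n) powr \<delta> * real n ^ 2 \<le> \<epsilon> * real n ^ 2"
proof -
  define b where "b = (\<epsilon> / 2) powr (1 / \<delta>)"
  have "b > 0" using assms by (simp add: b_def)
  obtain N where N: "C / b < real N" using reals_Archimedean2 by blast
  have "2 * (C / real n) powr \<delta> * real n ^ 2 \<le> \<epsilon> * real n ^ 2" if "n \<ge> N" for n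
  proof -
    have n: "C / b < real n" using N that by linarith
    moreover have "0 \<le> C / b" using assms \<open>b > 0\<close> by simp
    ultimately have "0 < real n" by linarith
    with n \<open>b > 0\<close> have "C / real n \<le> b" by (simp add: field_simps)
    then have "(C / real n) powr \<delta> \<le> b powr \<delta>"
      using assms by (intro powr_mono2) auto
    also have "\<dots> = \<epsilon> / 2" using assms by (simp add: b_def powr_powr)
    finally show ?thesis by (intro mult_right_mono) auto
  qed
  then show ?thesis by blast
qed

theorem theorem4p3:
  fixes \<F> :: "'b graph set" and chi alpha :: nat
  assumes "\<F> \<noteq> {}" and "\<forall>F\<in>\<F>. fin_graph F"
    and "chi = family_chi \<F>" and "chi \<ge> 2" and "alpha = family_alpha \<F>"
  shows "indistinguishable
           (\<lambda>G :: 'a graph. comparability_graph G \<and> chromatic_number G \<le> chi - 1)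
           (\<lambda>G. comparability_graph G \<and> family_free \<F> G)
       \<and> (\<forall>G :: 'a graph. comparability_graph G \<and> chromatic_number G \<le> chi - 1
            \<longrightarrow> family_free \<F> G)
       \<and> (\<forall>G :: 'a graph. comparability_graph G \<and> family_free \<F> G \<longrightarrow>
            (\<exists>G'. spanning_subgraph G' G \<and> comparability_graph G'
               \<and> chromatic_number G' \<le> chi - 1
               \<and> real (card (edges G - edges G'))
                   \<le> 2 * ((real chi ^ 2 * real alpha ^ 2 / real (card (verts G)))
                           powr (1 / (real chi * real alpha ^ 2)))
                       * real (card (verts G)) ^ 2))"
proof -
  obtain F where F: "F \<in> \<F>" "chromatic_number F = chi" "independence_number F = alpha"
    using family_attained[OF assms(1)] assms(3,5) by metis
  have "fin_graph F" using F(1) assms(2) by blast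
  have "alpha > 0" using independence_number_pos[OF \<open>fin_graph F\<close>] F assms(4) by simp
  have free: "family_free \<F> G" if G: "comparability_graph G" "chromatic_number G \<le> chi - 1"
    for G :: "'a graph"
    unfolding family_free_def
  proof
    assume "\<exists>F\<in>\<F>. \<exists>H. subgraph H G \<and> isomorphic F H"
    then obtain F' H where "F' \<in> \<F>" "subgraph H G" "isomorphic F' H" by blast
    then have "chi \<le> chromatic_number G"
      using chromatic_number_copy_le[OF fin_graph_comparability_graph[OF G(1)]] family_chi_le assms(3)
      by (metis order_trans)
    with G(2) assms(4) show False by linarith
  qed
  have prune: "\<exists>G'. spanning_subgraph G' G \<and> comparability_graph G' \<and> chromatic_number G' \<le> chi - 1 \<and>
      real (card (edges G - edges G'))
        \<le> 2 * ((real chi ^ 2 * real alpha ^ 2 / real (card (verts G)))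
              powr (1 / (real chi * real alpha ^ 2))) * real (card (verts G)) ^ 2"
    if "comparability_graph G" "family_free \<F> G" for G :: "'a graph"
    using that F assms(4) \<open>fin_graph F\<close> unfolding family_free_def
    by (intro prune_comparability_graph[where F = F]) auto
  have colorable_property: "graph_property (\<lambda>G :: 'a graph. comparability_graph G \<and> chromatic_number G \<le> chi - 1)"
    unfolding graph_property_def
  proof (intro conjI allI impI; (elim conjE)?)
    fix G H :: "'a graph"
    assume G: "comparability_graph G" "chromatic_number G \<le> chi - 1"
      and H: "fin_graph H" "isomorphic G H"
    show "comparability_graph H" using comparability_graph_isomorphic G H by blast
    have "fin_graph G" using G fin_graph_comparability_graph by blast
    then have "chromatic_number H \<le> chromatic_number G"
      using chromatic_number_copy_le subgraph_refl isomorphic_sym H by blast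
    then show "chromatic_number H \<le> chi - 1" using G by linarith
  qed (rule fin_graph_comparability_graph)
  have free_property: "graph_property (\<lambda>G :: 'a graph. comparability_graph G \<and> family_free \<F> G)"
    unfolding graph_property_def
  proof (intro conjI allI impI; (elim conjE)?)
    fix G H :: "'a graph"
    assume G: "comparability_graph G" "family_free \<F> G" and H: "fin_graph H" "isomorphic G H"
    show "comparability_graph H" using comparability_graph_isomorphic G H by blast
    show "family_free \<F> H"
      using family_free_isomorphic[OF fin_graph_comparability_graph] G H by blast
  qed (rule fin_graph_comparability_graph)
  have forward: "approximable_by (\<lambda>G :: 'a graph. comparability_graph G \<and> chromatic_number G \<le> chi - 1)
      (\<lambda>G. comparability_graph G \<and> family_free \<F> G)"
    unfolding approximable_by_def
  proof (intro allI impI exI[of _ 0])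
    fix \<epsilon> :: real and G :: "'a graph"
    assume "\<epsilon> > 0" "(comparability_graph G \<and> chromatic_number G \<le> chi - 1) \<and> 0 \<le> card (verts G)"
    then show "\<exists>G'. (comparability_graph G' \<and> family_free \<F> G') \<and> verts G' = verts G \<and>
        real (card (sym_diff (edges G) (edges G'))) \<le> \<epsilon> * real (card (verts G)) ^ 2"
      using free by (intro exI[of _ G]) auto
  qed
  have backward: "approximable_by (\<lambda>G :: 'a graph. comparability_graph G \<and> family_free \<F> G)
      (\<lambda>G. comparability_graph G \<and> chromatic_number G \<le> chi - 1)"
    unfolding approximable_by_def
  proof (intro allI impI)
    fix \<epsilon> :: real assume "\<epsilon> > 0"
    have "1 / (real chi * real alpha ^ 2) > 0" "real chi ^ 2 * real alpha ^ 2 \<ge> 0"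
      using assms(4) \<open>alpha > 0\<close> by simp_all
    from powr_bound_eventually_small[OF this(2,1) \<open>\<epsilon> > 0\<close>]
    obtain N where N: "2 * (real chi ^ 2 * real alpha ^ 2 / real n)
        powr (1 / (real chi * real alpha ^ 2)) * real n ^ 2 \<le> \<epsilon> * real n ^ 2" if "n \<ge> N" for n
      by blast
    have "\<exists>G'. (comparability_graph G' \<and> chromatic_number G' \<le> chi - 1) \<and> verts G' = verts G \<and>
        real (card (sym_diff (edges G) (edges G'))) \<le> \<epsilon> * real (card (verts G)) ^ 2"
      if G: "comparability_graph G" "family_free \<F> G" "N \<le> card (verts G)" for G :: "'a graph"
    proof -
      obtain G' where G': "spanning_subgraph G' G" "comparability_graph G'" "chromatic_number G' \<le> chi - 1"
        and small: "real (card (edges G - edges G'))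
          \<le> 2 * ((real chi ^ 2 * real alpha ^ 2 / real (card (verts G)))
                powr (1 / (real chi * real alpha ^ 2))) * real (card (verts G)) ^ 2"
        using prune[OF G(1,2)] by blast
      have "sym_diff (edges G) (edges G') = edges G - edges G'"
        using G'(1) by (auto simp: spanning_subgraph_def subgraph_def)
      then have "real (card (sym_diff (edges G) (edges G'))) \<le> \<epsilon> * real (card (verts G)) ^ 2"
        using small N[OF G(3)] by simp
      moreover have "verts G' = verts G" using G'(1) by (simp add: spanning_subgraph_def)
      ultimately show ?thesis using G'(2,3) by blast
    qed
    then show "\<exists>N. \<forall>G :: 'a graph. (comparability_graph G \<and> family_free \<F> G) \<and> N \<le> card (verts G) \<longrightarrow>
        (\<exists>G'. (comparability_graph G' \<and> chromatic_number G' \<le> chi - 1) \<and> verts G' = verts G \<and>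
          real (card (sym_diff (edges G) (edges G'))) \<le> \<epsilon> * real (card (verts G)) ^ 2)"
      by blast
  qed
  show ?thesis
    unfolding indistinguishable_def
    using colorable_property free_property forward backward free prune by blast
qed

end
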